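(* Let $1\le p\le n$, $\lambda>0$, and let $f:\mathbb{R}^{n\times p}\to\mathbb{R}$ be continuously differentiable with locally Lipschitz continuous gradient $\nabla f$. If $X^*\in\mathrm{St}(p,n)$ is both a local minimum and an isolated critical point of $f$ relative to the Stiefel manifold $\mathrm{St}(p,n)$, then $X^*$ is an asymptotically stable point of the landing system $\dot X(t)=-\Lambda(X(t))$.
   Context: Notation: $\mathrm{skew}(A)=\frac12(A-A^\top)$ for square $A$; $\|\cdot\|_{\mathrm F}$ is the Frobenius norm; $\nabla$ denotes the Euclidean gradient with respect to the Frobenius inner product. The Stiefel manifold is $\mathrm{St}(p,n)=\{X\in\mathbb{R}^{n\times p}:X^\top X=I_p\}$. The landing field $\Lambda:\mathbb{R}^{n\times p}\to\mathbb{R}^{n\times p}$ is $$\Lambda(X)=\psi(X)X+\lambda\nabla\mathcal{N}(X),\quad \psi(X)=2\,\mathrm{skew}(\nabla f(X)X^\top),\quad \mathcal{N}(X)=\tfrac14\|X^\top X-I_p\|_{\mathrm F}^2,$$ so that $\nabla\mathcal{N}(X)=X(X^\top X-I_p)$. The set of critical points of $f$ relative to $\mathrm{St}(p,n)$ is $\mathcal{C}=\{X\in\mathrm{St}(p,n):\psi(X)X=0\}$; a critical point is isolated if it is an isolated point of $\mathcal{C}$. A local minimum relative to $\mathrm{St}(p,n)$ is a local minimizer of the restriction $f|_{\mathrm{St}(p,n)}$. A point $X^*$ with $\Lambda(X^* )=0$ is stable if for every $\epsilon>0$ there is $\delta>0$ such that every solution of the landing system in $\mathbb{R}^{n\times p}$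 with $\|X(0)-X^*\|<\delta$ satisfies $\|X(t)-X^*\|<\epsilon$ for all $t\ge0$. It is asymptotically stable if it is stable and there is $\delta>0$ such that $\|X(0)-X^*\|<\delta$ implies $\lim_{t\to\infty}X(t)=X^*$. *)

theory Defs
  imports "HOL-Analysis.Analysis"
begin

section \<open>Gradients and local minima\<close>

text \<open>
  An \<open>n \<times> p\<close> real matrix has type \<open>real ^ 'p ^ 'n\<close>, with \<open>n = CARD('n)\<close> and \<open>p = CARD('p)\<close>.
  The library inner product and norm of this type are the sum of the entrywise products and
  the Euclidean norm of the entries, i.e.\ the Frobenius inner product and norm, so \<open>grad\<close> is
  the Euclidean gradient for the Frobenius inner product.
\<close>

definition grad :: "('a::real_inner \<Rightarrow> real) \<Rightarrow> 'a \<Rightarrow> 'a" where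
  "grad f x = (THE D. GDERIV f x :> D)"

lemma gderiv_unique:
  assumes "GDERIV f x :> D" "GDERIV f x :> E"
  shows "D = E"
proof -
  have "(\<lambda>h. inner h D) = (\<lambda>h. inner h E)"
    using assms has_derivative_unique unfolding gderiv_def by blast
  then have "inner (D - E) D = inner (D - E) E" by metis
  then have "inner (D - E) (D - E) = 0" by (simp add: inner_diff_right)
  then show ?thesis by simp
qed

lemma grad_eqI: "GDERIV f x :> D \<Longrightarrow> grad f x = D"
  unfolding grad_def by (rule the_equality) (auto intro: gderiv_unique)

lemma gderiv_grad:
  fixes f :: "'a::euclidean_space \<Rightarrow> real"
  assumes "f differentiable (at x)"
  shows "GDERIV f x :> grad f x"
proof -
  obtain f' where f': "(f has_derivative f') (at x)"
    using assms unfolding differentiable_def by blast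
  then have lin: "linear f'" by (rule has_derivative_linear)
  have "f' = (\<lambda>h. inner h (adjoint f' 1))"
    using adjoint_works[OF lin] by (metis inner_real_def mult.right_neutral)
  then have "GDERIV f x :> adjoint f' 1" using f' unfolding gderiv_def by simp
  then show ?thesis using grad_eqI by metis
qed

definition local_min_on :: "('a::metric_space \<Rightarrow> real) \<Rightarrow> 'a set \<Rightarrow> 'a \<Rightarrow> bool" where
  "local_min_on f S x \<longleftrightarrow> x \<in> S \<and> (\<exists>r>0. \<forall>y\<in>S. dist y x < r \<longrightarrow> f x \<le> f y)"


section \<open>The Stiefel manifold and the landing field\<close>

definition skew :: "real ^ 'n ^ 'n \<Rightarrow> real ^ 'n ^ 'n" where
  "skew A = (1 / 2) *\<^sub>R (A - transpose A)"

definition stiefel :: "(real ^ 'p ^ 'n) set" where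
  "stiefel = {X. transpose X ** X = mat 1}"

definition penalty :: "real ^ 'p ^ 'n \<Rightarrow> real" where
  "penalty X = (1 / 4) * (norm (transpose X ** X - mat 1))\<^sup>2"

definition psi :: "(real ^ 'p ^ 'n \<Rightarrow> real) \<Rightarrow> real ^ 'p ^ 'n \<Rightarrow> real ^ 'n ^ 'n" where
  "psi f X = 2 *\<^sub>R skew (grad f X ** transpose X)"

definition landing :: "real \<Rightarrow> (real ^ 'p ^ 'n \<Rightarrow> real) \<Rightarrow> real ^ 'p ^ 'n \<Rightarrow> real ^ 'p ^ 'n" where
  "landing lam f X = psi f X ** X + lam *\<^sub>R grad penalty X"

definition critical_points :: "(real ^ 'p ^ 'n \<Rightarrow> real) \<Rightarrow> (real ^ 'p ^ 'n) set" where
  "critical_points f = {X \<in> stiefel. psi f X ** X = 0}"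


section \<open>Asymptotic stability for autonomous systems\<close>

text \<open>
  \<open>solution F X T\<close>: the curve \<open>X\<close> solves \<open>X' = F(X)\<close> on \<open>[0, T)\<close>, where \<open>0 < T \<le> \<infinity>\<close>; the
  derivative at time \<open>0\<close> is one-sided and the values of \<open>X\<close> outside \<open>[0, T)\<close> are irrelevant.
\<close>

definition solution ::
    "('a::real_normed_vector \<Rightarrow> 'a) \<Rightarrow> (real \<Rightarrow> 'a) \<Rightarrow> ereal \<Rightarrow> bool" where
  "solution F X T \<longleftrightarrow> 0 < T \<and>
     (\<forall>t\<ge>0. ereal t < T \<longrightarrow> (X has_vector_derivative F (X t)) (at t within {0..}))"

definition maximal_solution ::
    "('a::real_normed_vector \<Rightarrow> 'a) \<Rightarrow> (real \<Rightarrow> 'a) \<Rightarrow> ereal \<Rightarrow> bool" where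
  "maximal_solution F X T \<longleftrightarrow> solution F X T \<and>
     \<not> (\<exists>Y S. T < S \<and> solution F Y S \<and> (\<forall>t\<ge>0. ereal t < T \<longrightarrow> Y t = X t))"

text \<open>
  Quantifying over maximal solutions and demanding \<open>T = \<infinity>\<close> makes global existence part of
  the assertion ``for all \<open>t \<ge> 0\<close>'': a trajectory that blows up in finite time violates
  stability instead of being ignored.
\<close>

definition stable_point :: "('a::real_normed_vector \<Rightarrow> 'a) \<Rightarrow> 'a \<Rightarrow> bool" where
  "stable_point F x \<longleftrightarrow> F x = 0 \<and>
     (\<forall>\<epsilon>>0. \<exists>\<delta>>0. \<forall>X T. maximal_solution F X T \<and> norm (X 0 - x) < \<delta> \<longrightarrow>
        T = \<infinity> \<and> (\<forall>t\<ge>0. norm (X t - x) < \<epsilon>))"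

definition asymptotically_stable_point :: "('a::real_normed_vector \<Rightarrow> 'a) \<Rightarrow> 'a \<Rightarrow> bool" where
  "asymptotically_stable_point F x \<longleftrightarrow> stable_point F x \<and>
     (\<exists>\<delta>>0. \<forall>X T. maximal_solution F X T \<and> norm (X 0 - x) < \<delta> \<longrightarrow>
        T = \<infinity> \<and> (X \<longlongrightarrow> x) at_top)"

end

theory Submission
  imports Defs
begin

text \<open>
  With \<open>e(X) = \<parallel>X\<^sup>T X - I\<parallel>\<close>, the function \<open>V = f + K e\<close> is a Lyapunov function for large \<open>K\<close>. Along
  the flow \<open>f\<close> decreases at rate \<open>1/2 \<parallel>\<psi>\<parallel>\<^sup>2\<close> up to an error \<open>O(e)\<close>, which the decrease of \<open>K e\<close>
  absorbs, so \<open>V\<close> decreases at rate at least \<open>1/2 \<parallel>\<psi>\<parallel>\<^sup>2 + e\<close>; near \<open>X\<^sup>*\<close> this vanishes only at the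
  isolated critical point \<open>X\<^sup>*\<close>. Every \<open>X\<close> with small \<open>e(X)\<close> is within \<open>e(X)\<close> of a point of the
  manifold, hence \<open>V(X) \<ge> V(X\<^sup>*)\<close> by local minimality. Equality forces \<open>X\<close> to be a local minimum on
  the manifold, so a critical point, so \<open>X\<^sup>*\<close>.
\<close>

section \<open>Ordinary differential equations\<close>

lemma at_within_Icc_eq_atLeast:
  fixes t :: real
  assumes "t < b"
  shows "at t within {a..b} = at t within {a..}"
  by (rule at_within_nhd[of _ "{..<b}"]) (use assms in auto)

text \<open>The Picard operator is a contraction on the whole half-line at once if curves are
  weighted by \<open>exp (- a * t)\<close> with \<open>a\<close> large against \<open>L\<close>, so
  no gluing of local solutions is needed. The unknown \<open>v\<close> of the fixed-point equation
  is the weighted curve, an element of the Banach space of bounded continuous functions.\<close>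

lemma bounded_lipschitz_global_solution:
  fixes F :: "'a::banach \<Rightarrow> 'a"
  assumes L: "L-lipschitz_on UNIV F" and M: "\<And>x. norm (F x) \<le> M"
  obtains u where "u 0 = x0"
    "\<And>t. t \<ge> 0 \<Longrightarrow> (u has_vector_derivative F (u t)) (at t within {0..})"
proof -
  have L0: "L \<ge> 0" using L by (rule lipschitz_on_nonneg)
  have M0: "M \<ge> 0" using M[of 0] norm_ge_zero order_trans by blast
  \<comment> \<open>The contraction factor will be \<open>L / a\<close>; the summand 1 keeps
    \<open>a\<close> positive when \<open>L = 0\<close>.\<close>
  define a where "a = 2 * L + 1"
  have a: "a > 0" "L / a \<le> 1 / 2" using L0 by (auto simp: a_def field_simps)
  define h where "h v s = F (exp (a * s) *\<^sub>R apply_bcontfun v s)" for v :: "real \<Rightarrow>\<^sub>C 'a" and s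
  define I where "I v t = integral {0..t} (h v)" for v t
  have contF: "continuous_on UNIV F" using L by (rule lipschitz_on_continuous_on)
  have conth: "continuous_on S (h v)" for S v
    unfolding h_def by (intro continuous_on_compose2[OF contF] continuous_intros) auto
  have der: "(I v has_vector_derivative h v t) (at t within {0..})" if "t \<ge> 0" for v t
    using integral_has_vector_derivative[OF conth, of t 0 "t + 1" v] that
      at_within_Icc_eq_atLeast[of t "t + 1" 0]
    by (simp add: I_def[abs_def])
  have contI: "continuous_on {0..} (I v)" for v
    unfolding continuous_on_eq_continuous_within
    using der has_vector_derivative_continuous by (metis atLeast_iff)
  have normI: "norm (I v t) \<le> M * t" if "t \<ge> 0" for v t
    using integral_bound[of 0 t "h v" M] that conth M by (simp add: I_def h_def)
  \<comment> \<open>The Picard operator conjugated with the weight. Bounded continuous functions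
    live on all of the reals, so \<open>max 0 t\<close> extends the curve by the constant
    \<open>x0\<close> to negative times.\<close>
  define G where "G v t = exp (- a * max 0 t) *\<^sub>R (x0 + I v (max 0 t))" for v t
  have G: "G v \<in> bcontfun" for v
  proof (rule bcontfun_normI)
    show "continuous_on UNIV (G v)"
      unfolding G_def
      by (intro continuous_intros continuous_on_compose2[OF contI]) auto
  next
    fix t :: real
    define s where "s = max 0 t"
    have s: "s \<ge> 0" by (simp add: s_def)
    \<comment> \<open>A bounded field gives at most linear growth \<open>M * s\<close> of the
      integral, which the weight turns into a bounded term.\<close>
    have "a * s \<le> exp (a * s)" using exp_ge_add_one_self[of "a * s"] by linarith
    then have 1: "exp (- a * s) * s \<le> 1 / a"
      using a by (simp add: exp_minus field_simps)
    have "norm (G v t) \<le> exp (- a * s) * (norm x0 + M * s)"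
      using normI[OF s, of v] norm_triangle_ineq[of x0 "I v s"]
      by (simp add: G_def s_def[symmetric])
    also have "\<dots> = exp (- a * s) * norm x0 + M * (exp (- a * s) * s)"
      by (simp add: algebra_simps)
    also have "\<dots> \<le> 1 * norm x0 + M * (1 / a)"
      using 1 M0 a s by (intro add_mono mult_right_mono mult_left_mono) auto
    finally show "norm (G v t) \<le> 1 * norm x0 + M * (1 / a)" .
  qed
  have contr: "dist (Bcontfun (G v)) (Bcontfun (G w)) \<le> 1 / 2 * dist v w" for v w
  proof (rule dist_bound)
    fix t :: real
    define s where "s = max 0 t"
    have s: "s \<ge> 0" by (simp add: s_def)
    define D where "D = dist v w"
    have D0: "D \<ge> 0" by (simp add: D_def)
    \<comment> \<open>Integrating the exponential weight is what gains the factor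
      \<open>1 / a\<close>.\<close>
    have int: "((\<lambda>\<tau>. L * D * exp (a * \<tau>)) has_integral
        (L * D * exp (a * s) / a - L * D * exp (a * 0) / a)) {0..s}"
      by (rule fundamental_theorem_of_calculus[OF s])
        (use a in \<open>auto intro!: derivative_eq_intros simp: has_real_derivative_iff_has_vector_derivative[symmetric]\<close>)
    have "norm (I v s - I w s) = norm (integral {0..s} (\<lambda>\<tau>. h v \<tau> - h w \<tau>))"
      unfolding I_def by (subst integral_diff) (auto intro!: integrable_continuous_real conth)
    also have "\<dots> \<le> integral {0..s} (\<lambda>\<tau>. L * D * exp (a * \<tau>))"
    proof (rule integral_norm_bound_integral)
      show "(\<lambda>\<tau>. h v \<tau> - h w \<tau>) integrable_on {0..s}"
        by (intro integrable_continuous_real continuous_on_diff conth)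
      show "(\<lambda>\<tau>. L * D * exp (a * \<tau>)) integrable_on {0..s}"
        using int by blast
      fix \<tau>
      have "norm (h v \<tau> - h w \<tau>)
          \<le> L * norm (exp (a * \<tau>) *\<^sub>R apply_bcontfun v \<tau> - exp (a * \<tau>) *\<^sub>R apply_bcontfun w \<tau>)"
        unfolding h_def using lipschitz_on_normD[OF L] by auto
      also have "\<dots> = L * (exp (a * \<tau>) * dist (apply_bcontfun v \<tau>) (apply_bcontfun w \<tau>))"
        by (simp add: scaleR_diff_right[symmetric] dist_norm)
      also have "\<dots> \<le> L * (exp (a * \<tau>) * D)"
        unfolding D_def using L0 by (intro mult_left_mono dist_bounded) auto
      finally show "norm (h v \<tau> - h w \<tau>) \<le> L * D * exp (a * \<tau>)" by (simp add: ac_simps)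
    qed
    also have "\<dots> = L * D * exp (a * s) / a - L * D / a"
      using integral_unique[OF int] by simp
    also have "\<dots> \<le> L / a * D * exp (a * s)"
      using L0 D0 a by simp
    finally have 1: "norm (I v s - I w s) \<le> L / a * D * exp (a * s)" .
    have "dist (G v t) (G w t) = exp (- a * s) * norm (I v s - I w s)"
      by (simp add: G_def s_def[symmetric] dist_norm scaleR_diff_right[symmetric])
    also have "\<dots> \<le> exp (- a * s) * (L / a * D * exp (a * s))"
      using 1 by (intro mult_left_mono) auto
    also have "\<dots> = L / a * D" by (simp add: exp_minus)
    also have "\<dots> \<le> 1 / 2 * D" using a D0 by (intro mult_right_mono) auto
    finally show "dist (apply_bcontfun (Bcontfun (G v)) t) (apply_bcontfun (Bcontfun (G w)) t)
        \<le> 1 / 2 * dist v w"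
      using G by (simp add: Bcontfun_inverse D_def)
  qed
  obtain v where v: "Bcontfun (G v) = v"
    using banach_fix_type[of "1/2" "\<lambda>v. Bcontfun (G v)"] contr by auto
  define u where "u t = x0 + I v t" for t
  have vG: "apply_bcontfun v t = G v t" for t
    by (metis v G Bcontfun_inverse)
  have uv: "exp (a * t) *\<^sub>R apply_bcontfun v t = u t" if "t \<ge> 0" for t
    unfolding vG G_def u_def using that by (simp add: exp_minus)
  show ?thesis
  proof (rule that)
    show "u 0 = x0" by (simp add: u_def I_def)
    show "(u has_vector_derivative F (u t)) (at t within {0..})" if "t \<ge> 0" for t
      using has_vector_derivative_add[OF has_vector_derivative_const[of x0] der[OF that, of v]]
        uv[OF that]
      by (simp add: u_def[abs_def] h_def)
  qed
qed

text \<open>Gronwall in differential form: by Cauchy-Schwarz and the Lipschitz bound, the squared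
  distance times \<open>exp (- (2 * L * t))\<close> has nonpositive derivative, and it starts at
  0.\<close>

lemma lipschitz_solution_unique:
  fixes F :: "'a::real_inner \<Rightarrow> 'a"
  assumes L: "L-lipschitz_on S F" and b: "0 \<le> b"
    and X: "\<And>t. t \<in> {0..b} \<Longrightarrow> (X has_vector_derivative F (X t)) (at t within {0..b})"
    and Z: "\<And>t. t \<in> {0..b} \<Longrightarrow> (Z has_vector_derivative F (Z t)) (at t within {0..b})"
    and S: "\<And>t. t \<in> {0..b} \<Longrightarrow> X t \<in> S \<and> Z t \<in> S"
    and "X 0 = Z 0"
  shows "X b = Z b"
proof -
  define d where "d t = exp (- (2 * L * t)) * ((X t - Z t) \<bullet> (X t - Z t))" for t
  have "(d has_derivative (\<lambda>h. h * (exp (- (2 * L * t)) *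
      (2 * ((F (X t) - F (Z t)) \<bullet> (X t - Z t)) - 2 * L * ((X t - Z t) \<bullet> (X t - Z t))))))
      (at t within {0..b})" if "t \<in> {0..b}" for t
    unfolding d_def
    using X[OF that] Z[OF that] unfolding has_vector_derivative_def
    by (auto intro!: derivative_eq_intros simp: algebra_simps inner_commute)
  from mvt_very_simple[OF b this]
  obtain t where t: "t \<in> {0..b}" and "d b - d 0 = b * (exp (- (2 * L * t)) *
      (2 * ((F (X t) - F (Z t)) \<bullet> (X t - Z t)) - 2 * L * ((X t - Z t) \<bullet> (X t - Z t))))"
    by auto
  moreover have "(F (X t) - F (Z t)) \<bullet> (X t - Z t) \<le> L * ((X t - Z t) \<bullet> (X t - Z t))"
  proof -
    have "(F (X t) - F (Z t)) \<bullet> (X t - Z t) \<le> norm (F (X t) - F (Z t)) * norm (X t - Z t)"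
      by (rule norm_cauchy_schwarz)
    also have "\<dots> \<le> (L * norm (X t - Z t)) * norm (X t - Z t)"
      using lipschitz_on_normD[OF L] S[OF t] by (intro mult_right_mono) auto
    finally show ?thesis by (simp add: power2_norm_eq_inner[symmetric] power2_eq_square ac_simps)
  qed
  ultimately have "d b - d 0 \<le> 0"
    using b by (auto intro!: mult_nonneg_nonpos)
  then have "exp (- (2 * L * b)) * ((X b - Z b) \<bullet> (X b - Z b)) \<le> 0"
    using \<open>X 0 = Z 0\<close> by (simp add: d_def)
  then have "(norm (X b - Z b))\<^sup>2 \<le> 0"
    by (simp add: mult_le_0_iff not_le[symmetric] power2_norm_eq_inner)
  then show ?thesis by simp
qed

lemma solution_within:
  assumes "solution F X T" "0 \<le> s" "ereal t < T" "\<tau> \<in> {s..t}"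
  shows "(X has_vector_derivative F (X \<tau>)) (at \<tau> within {s..t})"
proof -
  have "ereal \<tau> < T" using assms(3,4) by (auto intro: le_less_trans[of _ "ereal t"])
  then have "(X has_vector_derivative F (X \<tau>)) (at \<tau> within {0..})"
    using assms by (auto simp: solution_def)
  then show ?thesis
    by (rule has_vector_derivative_within_subset) (use assms in auto)
qed

text \<open>If the lifetime were a finite \<open>b\<close>, a global solution \<open>Z\<close> of a
  field modified outside the ball would agree with \<open>X\<close> before \<open>b\<close> and
  still solve the original equation slightly beyond \<open>b\<close>, contradicting maximality. The
  gap between \<open>\<rho>\<close> and \<open>r\<close> leaves room for this.\<close>

lemma trapped_maximal_solution_global:
  fixes F :: "'a::euclidean_space \<Rightarrow> 'a"
  assumes L: "L-lipschitz_on (cball x r) F" and \<rho>: "\<rho> < r"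
    and max: "maximal_solution F X T"
    and trap: "\<And>t. t \<ge> 0 \<Longrightarrow> ereal t < T \<Longrightarrow> norm (X t - x) < \<rho>"
  shows "T = \<infinity>"
proof (rule ccontr)
  assume "T \<noteq> \<infinity>"
  have sol: "solution F X T" and "T > 0"
    using max by (auto simp: maximal_solution_def solution_def)
  then obtain b where b: "T = ereal b" "b > 0"
    using \<open>T \<noteq> \<infinity>\<close> by (cases T) auto
  define B where "B = cball x r"
  have "\<rho> > 0" using trap[of 0] \<open>T > 0\<close> norm_ge_zero[of "X 0 - x"]
    by (auto simp: zero_ereal_def simp del: norm_ge_zero)
  then have r: "r > 0" using \<rho> by simp
  have B: "convex B" "closed B" "B \<noteq> {}" using r by (auto simp: B_def)
  \<comment> \<open>Projection onto a closed convex set is 1-Lipschitz, so \<open>H\<close> is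
    globally \<open>L\<close>-Lipschitz; compactness of the ball makes it bounded. On the ball it
    equals \<open>F\<close>.\<close>
  define H where "H y = F (closest_point B y)" for y
  have cp: "closest_point B y \<in> B" for y
    using B by (simp add: closest_point_in_set)
  have HF: "H y = F y" if "y \<in> B" for y
    using that by (simp add: H_def closest_point_self)
  have "1-lipschitz_on UNIV (closest_point B)"
    using closest_point_lipschitz[OF B] by (intro lipschitz_onI) auto
  moreover have "L-lipschitz_on (closest_point B ` UNIV) F"
    by (rule lipschitz_on_subset[OF L]) (use cp in \<open>auto simp: B_def\<close>)
  ultimately have "(L * 1)-lipschitz_on UNIV (\<lambda>y. F (closest_point B y))"
    by (rule lipschitz_on_compose2)
  then have LH: "L-lipschitz_on UNIV H" by (simp add: H_def[abs_def])
  have "bounded (F ` B)"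
    using L lipschitz_on_continuous_on compact_continuous_image compact_cball compact_imp_bounded
    unfolding B_def by blast
  then obtain M where "\<And>y. y \<in> B \<Longrightarrow> norm (F y) \<le> M" by (auto simp: bounded_iff)
  then have M: "\<And>y. norm (H y) \<le> M" using cp by (simp add: H_def)
  obtain Z where Z0: "Z 0 = X 0"
    and Z: "\<And>t. t \<ge> 0 \<Longrightarrow> (Z has_vector_derivative H (Z t)) (at t within {0..})"
    using bounded_lipschitz_global_solution[OF LH M] by blast
  have XB: "X t \<in> B" if "t \<ge> 0" "t < b" for t
    using trap[of t] that \<rho> by (auto simp: b B_def dist_norm norm_minus_commute)
  have ZX: "Z t = X t" if t: "t \<ge> 0" "t < b" for t
  proof (rule lipschitz_solution_unique[OF LH t(1), of Z X])
    fix s assume s: "s \<in> {0..t}"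
    show "(Z has_vector_derivative H (Z s)) (at s within {0..t})"
      by (rule has_vector_derivative_within_subset[OF Z]) (use s in auto)
    show "(X has_vector_derivative H (X s)) (at s within {0..t})"
      using solution_within[OF sol order_refl _ s] t s b XB[of s] by (auto simp: HF)
  qed (use Z0 in auto)
  have contZ: "continuous_on {0..} Z"
    unfolding continuous_on_eq_continuous_within
    using Z has_vector_derivative_continuous by (metis atLeast_iff)
  have Zb: "norm (Z b - x) \<le> \<rho>"
  proof (rule tendsto_upperbound)
    have "(Z \<longlongrightarrow> Z b) (at b within {0..})"
      using contZ b by (auto simp: continuous_on_def)
    then have "(Z \<longlongrightarrow> Z b) (at b within {0..<b})"
      by (rule tendsto_within_subset) auto
    then show "((\<lambda>t. norm (Z t - x)) \<longlongrightarrow> norm (Z b - x)) (at b within {0..<b})"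
      by (intro tendsto_intros)
    show "\<forall>\<^sub>F t in at b within {0..<b}. norm (Z t - x) \<le> \<rho>"
      using ZX trap b by (auto simp: eventually_at_filter intro!: always_eventually less_imp_le)
    show "at b within {0..<b} \<noteq> bot"
      using b by (simp add: at_within_eq_bot_iff)
  qed
  \<comment> \<open>In the limit the trapping bound survives as a weak inequality, so
    \<open>Z b\<close> is still strictly inside the ball and continuity keeps \<open>Z\<close> in it
    for a further time \<open>d\<close>.\<close>
  have "continuous (at b within {0..}) (\<lambda>t. norm (Z t - x))"
    using contZ b by (auto simp: continuous_on_eq_continuous_within intro!: continuous_intros)
  then obtain d where d: "d > 0"
    "\<And>t. t \<ge> 0 \<Longrightarrow> dist t b < d \<Longrightarrow> dist (norm (Z t - x)) (norm (Z b - x)) < r - \<rho>"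
    using \<rho> unfolding continuous_within_eps_delta by (metis atLeast_iff diff_gt_0_iff_gt)
  have ZB: "Z t \<in> B" if t: "t \<ge> 0" "t < b + d" for t
  proof (cases "t < b")
    case True
    then show ?thesis using ZX XB t by simp
  next
    case False
    then have "dist (norm (Z t - x)) (norm (Z b - x)) < r - \<rho>"
      using d(2)[of t] t by (auto simp: dist_real_def)
    then have "norm (Z t - x) \<le> r" using Zb by (auto simp: dist_real_def)
    then show ?thesis by (simp add: B_def dist_norm norm_minus_commute)
  qed
  have "(Z has_vector_derivative F (Z t)) (at t within {0..})" if "t \<ge> 0" "t < b + d" for t
    using Z[OF that(1)] HF[OF ZB[OF that]] by simp
  then have "solution F Z (ereal (b + d))"
    unfolding solution_def using b d by (auto simp: zero_ereal_def)
  moreover have "T < ereal (b + d)" using b d by simp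
  ultimately show False
    using max ZX unfolding maximal_solution_def b by (metis ereal_less_eq(3) less_ereal.simps(1))
qed

section \<open>Lyapunov functions\<close>

text \<open>Hypothesis \<open>dec\<close> is the integrated form of a decrease of \<open>V\<close>
  at rate \<open>w\<close>, so \<open>V\<close> need not be differentiable. The minimum of
  \<open>V\<close> on a small sphere is a barrier that trajectories cannot cross; away from
  \<open>x\<close> the rate is bounded below, so a trajectory that stayed away would push
  \<open>V\<close> below its minimum.\<close>

theorem lyapunov_asymptotically_stable:
  fixes F :: "'a::euclidean_space \<Rightarrow> 'a" and V w :: "'a \<Rightarrow> real"
  assumes r: "r > 0" and L: "L-lipschitz_on (cball x r) F" and Fx: "F x = 0"
    and V: "continuous_on (cball x r) V" and w: "continuous_on (cball x r) w"
    and Vpos: "\<And>y. y \<in> cball x r \<Longrightarrow> y \<noteq> x \<Longrightarrow> V x < V y"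
    and wpos: "\<And>y. y \<in> cball x r \<Longrightarrow> y \<noteq> x \<Longrightarrow> 0 < w y"
    and wx: "0 \<le> w x"
    and dec: "\<And>u s t c. s \<le> t \<Longrightarrow>
      (\<And>\<tau>. \<tau> \<in> {s..t} \<Longrightarrow> (u has_vector_derivative F (u \<tau>)) (at \<tau> within {s..t})) \<Longrightarrow>
      (\<And>\<tau>. \<tau> \<in> {s..t} \<Longrightarrow> u \<tau> \<in> cball x r \<and> c \<le> w (u \<tau>)) \<Longrightarrow>
      V (u t) \<le> V (u s) - c * (t - s)"
  shows "asymptotically_stable_point F x"
proof -
  have wnn: "0 \<le> w y" if "y \<in> cball x r" for y
    using wpos[OF that] wx by (cases "y = x") auto
  \<comment> \<open>The starting time \<open>s\<close> is arbitrary: stability uses time 0,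
    convergence restarts the argument at a later time.\<close>
  have trap: "\<exists>\<delta>>0. \<forall>X T s. solution F X T \<longrightarrow> 0 \<le> s \<longrightarrow> norm (X s - x) < \<delta> \<longrightarrow>
      (\<forall>t\<ge>s. ereal t < T \<longrightarrow> norm (X t - x) < \<rho>)" if \<rho>: "0 < \<rho>" "\<rho> \<le> r" for \<rho>
  proof -
    have sub: "sphere x \<rho> \<subseteq> cball x r" using \<rho> by auto
    obtain z where z: "z \<in> sphere x \<rho>" "\<And>y. y \<in> sphere x \<rho> \<Longrightarrow> V z \<le> V y"
      using continuous_attains_inf[of "sphere x \<rho>" V] continuous_on_subset[OF V sub] \<rho>
      by (auto simp del: mem_sphere)
    have "V x < V z" using Vpos[of z] z(1) sub \<rho> by auto
    moreover have "continuous (at x within cball x r) V"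
      using V r by (auto simp: continuous_on_eq_continuous_within)
    ultimately obtain \<delta> where \<delta>: "\<delta> > 0"
      "\<And>y. y \<in> cball x r \<Longrightarrow> dist y x < \<delta> \<Longrightarrow> dist (V y) (V x) < V z - V x"
      unfolding continuous_within_eps_delta by (metis diff_gt_0_iff_gt)
    show ?thesis
    proof (intro exI[of _ "min \<delta> \<rho>"] conjI allI impI)
      show "min \<delta> \<rho> > 0" using \<delta> \<rho> by simp
      fix X T s t
      assume sol: "solution F X T" and s: "0 \<le> s" and Xs: "norm (X s - x) < min \<delta> \<rho>"
        and t: "s \<le> t" "ereal t < T"
      show "norm (X t - x) < \<rho>"
      proof (rule ccontr)
        assume "\<not> norm (X t - x) < \<rho>"
        have der: "(X has_vector_derivative F (X \<tau>)) (at \<tau> within {s..t})" if "\<tau> \<in> {s..t}" for \<tau>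
          using solution_within[OF sol s t(2) that] .
        then have contX: "continuous_on {s..t} X"
          unfolding continuous_on_eq_continuous_within
          using has_vector_derivative_continuous by blast
        define K where "K = {\<tau> \<in> {s..t}. \<rho> \<le> norm (X \<tau> - x)}"
        have "K = {s..t} \<inter> (\<lambda>\<tau>. norm (X \<tau> - x)) -` {\<rho>..}" by (auto simp: K_def)
        moreover have "continuous_on {s..t} (\<lambda>\<tau>. norm (X \<tau> - x))"
          by (intro continuous_intros contX)
        ultimately have "closed K" by (simp add: continuous_closed_preimage)
        then have "compact K"
          by (auto simp: compact_eq_bounded_closed K_def intro: bounded_subset[of "{s..t}"])
        moreover have "t \<in> K" using \<open>\<not> norm (X t - x) < \<rho>\<close> t by (auto simp: K_def)
        \<comment> \<open>The first time at distance at least \<open>\<rho>\<close>. The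
          intermediate value theorem makes the distance exactly \<open>\<rho>\<close>, so the curve
          is in the ball up to then and on the sphere at \<open>\<tau>0\<close>.\<close>
        ultimately obtain \<tau>0 where \<tau>0: "\<tau>0 \<in> K" "\<And>\<tau>. \<tau> \<in> K \<Longrightarrow> \<tau>0 \<le> \<tau>"
          using compact_attains_inf[of K] by blast
        have \<tau>0': "s \<le> \<tau>0" "\<tau>0 \<le> t" "\<rho> \<le> norm (X \<tau>0 - x)" using \<tau>0(1) by (auto simp: K_def)
        have below: "norm (X \<tau> - x) < \<rho>" if "s \<le> \<tau>" "\<tau> < \<tau>0" for \<tau>
          using \<tau>0(2)[of \<tau>] that \<tau>0' by (force simp: K_def)
        have "continuous_on {s..\<tau>0} (\<lambda>\<tau>. norm (X \<tau> - x))"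
          by (intro continuous_intros continuous_on_subset[OF contX]) (use \<tau>0' in auto)
        from IVT'[OF _ \<tau>0'(3) \<tau>0'(1) this] Xs
        obtain \<tau> where "s \<le> \<tau>" "\<tau> \<le> \<tau>0" "norm (X \<tau> - x) = \<rho>" by auto
        with below[of \<tau>] have eq: "norm (X \<tau>0 - x) = \<rho>" by (cases "\<tau> = \<tau>0") auto
        have in_ball: "X \<tau> \<in> cball x r" if "\<tau> \<in> {s..\<tau>0}" for \<tau>
          using below[of \<tau>] eq that \<rho>
          by (cases "\<tau> = \<tau>0") (auto simp: dist_norm norm_minus_commute)
        \<comment> \<open>The rate \<open>c = 0\<close> suffices here: \<open>V\<close> does not
          increase, yet it starts below its minimum \<open>V z\<close> on the sphere.\<close>
        have "V (X \<tau>0) \<le> V (X s) - 0 * (\<tau>0 - s)"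
        proof (rule dec[OF \<tau>0'(1)])
          show "(X has_vector_derivative F (X \<tau>)) (at \<tau> within {s..\<tau>0})" if "\<tau> \<in> {s..\<tau>0}" for \<tau>
            by (rule has_vector_derivative_within_subset[OF der]) (use that \<tau>0' in auto)
        qed (use in_ball wnn in auto)
        moreover have "V (X s) < V z"
          using \<delta>(2)[of "X s"] in_ball[of s] Xs \<tau>0' by (auto simp: dist_norm dist_real_def)
        moreover have "V z \<le> V (X \<tau>0)"
          using z(2)[of "X \<tau>0"] eq by (simp add: dist_norm norm_minus_commute)
        ultimately show False by simp
      qed
    qed
  qed
  have glob: "\<exists>\<delta>>0. \<forall>X T. maximal_solution F X T \<and> norm (X 0 - x) < \<delta> \<longrightarrow>
      T = \<infinity> \<and> (\<forall>t\<ge>0. norm (X t - x) < \<rho>)" if \<rho>: "0 < \<rho>" "\<rho> < r" for \<rho>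
  proof -
    obtain \<delta> where \<delta>: "\<delta> > 0" "\<And>X T s t. solution F X T \<Longrightarrow> 0 \<le> s \<Longrightarrow> norm (X s - x) < \<delta> \<Longrightarrow>
      t\<ge>s \<Longrightarrow> ereal t < T \<Longrightarrow> norm (X t - x) < \<rho>"
      using trap[of \<rho>] \<rho> by (metis less_imp_le)
    have "T = \<infinity> \<and> (\<forall>t\<ge>0. norm (X t - x) < \<rho>)"
      if X: "maximal_solution F X T" "norm (X 0 - x) < \<delta>" for X T
    proof -
      have sol: "solution F X T" using X by (simp add: maximal_solution_def)
      have tr: "norm (X t - x) < \<rho>" if "t \<ge> 0" "ereal t < T" for t
        using \<delta>(2)[OF sol order_refl X(2)] that by simp
      have "T = \<infinity>" by (rule trapped_maximal_solution_global[OF L \<rho>(2) X(1) tr])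
      then show ?thesis using tr by simp
    qed
    then show ?thesis using \<delta>(1) by blast
  qed
  have "stable_point F x"
    unfolding stable_point_def
  proof (intro conjI allI impI Fx)
    fix \<epsilon> :: real assume "\<epsilon> > 0"
    then have "0 < min \<epsilon> (r / 2)" "min \<epsilon> (r / 2) < r" using r by auto
    from glob[OF this] show "\<exists>\<delta>>0. \<forall>X T. maximal_solution F X T \<and> norm (X 0 - x) < \<delta> \<longrightarrow>
        T = \<infinity> \<and> (\<forall>t\<ge>0. norm (X t - x) < \<epsilon>)"
      by (metis min_less_iff_conj)
  qed
  moreover have "(X \<longlongrightarrow> x) at_top"
    if sol: "solution F X \<infinity>" and tr: "\<And>t. t \<ge> 0 \<Longrightarrow> norm (X t - x) < r" for X
  proof (rule tendstoI)
    fix \<epsilon> :: real assume "\<epsilon> > 0"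
    define \<rho> where "\<rho> = min \<epsilon> r"
    have "0 < \<rho>" "\<rho> \<le> r" using \<open>\<epsilon> > 0\<close> r by (auto simp: \<rho>_def)
    from trap[OF this] obtain \<delta> where \<delta>: "\<delta> > 0"
      "\<And>s t. 0 \<le> s \<Longrightarrow> norm (X s - x) < \<delta> \<Longrightarrow> t \<ge> s \<Longrightarrow> norm (X t - x) < \<rho>"
      using sol by auto
    have XB: "X t \<in> cball x r" if "t \<ge> 0" for t
      using tr[OF that] by (simp add: dist_norm norm_minus_commute)
    \<comment> \<open>One visit to the \<open>\<delta>\<close>-ball is enough, since
      \<open>trap\<close> then confines the trajectory for all later times.\<close>
    have "\<exists>s\<ge>0. norm (X s - x) < \<delta>"
    proof (rule ccontr)
      assume far: "\<not> ?thesis"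
      define A where "A = cball x r - ball x \<delta>"
      have XA: "X t \<in> A" if "t \<ge> 0" for t
        using far XB[OF that] that by (auto simp: A_def dist_norm norm_minus_commute)
      have "compact A" "A \<noteq> {}" "A \<subseteq> cball x r"
        unfolding A_def by (intro compact_diff) (use XA[of 0] in \<open>auto simp: A_def\<close>)
      then obtain z where z: "z \<in> A" "\<And>y. y \<in> A \<Longrightarrow> w z \<le> w y"
        using continuous_attains_inf[of A w] continuous_on_subset[OF w] by metis
      have "z \<noteq> x" using z(1) \<delta>(1) by (auto simp: A_def)
      then have wz: "w z > 0" using wpos[of z] z(1) by (simp add: A_def)
      have low: "V x \<le> V y" if "y \<in> cball x r" for y
        using Vpos[OF that] by (cases "y = x") auto
      \<comment> \<open>At this time the guaranteed decrease brings \<open>V\<close> down to at most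
        \<open>V x - w z\<close>.\<close>
      define t where "t = (V (X 0) - V x) / w z + 1"
      have t: "t \<ge> 0" using low[OF XB[of 0]] wz by (simp add: t_def)
      have "V (X t) \<le> V (X 0) - w z * (t - 0)"
      proof (rule dec[OF t])
        show "(X has_vector_derivative F (X \<tau>)) (at \<tau> within {0..t})" if "\<tau> \<in> {0..t}" for \<tau>
          using solution_within[OF sol order_refl _ that] by simp
      qed (use XB XA z in auto)
      also have "\<dots> < V x" using wz by (simp add: t_def field_simps)
      finally show False using low[OF XB[OF t]] by simp
    qed
    then obtain s where s: "s \<ge> 0" "norm (X s - x) < \<delta>" by blast
    show "\<forall>\<^sub>F t in at_top. dist (X t) x < \<epsilon>"
      using \<delta>(2)[OF s] by (auto simp: eventually_at_top_linorder dist_norm \<rho>_def)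
  qed
  moreover obtain \<delta> where "\<delta> > 0" "\<And>X T. maximal_solution F X T \<Longrightarrow> norm (X 0 - x) < \<delta> \<Longrightarrow>
      T = \<infinity> \<and> (\<forall>t\<ge>0. norm (X t - x) < r / 2)"
    using glob[of "r / 2"] r by auto
  ultimately show ?thesis
    unfolding asymptotically_stable_point_def
    using r by (smt (verit) field_sum_of_halves maximal_solution_def)
qed

section \<open>The Frobenius inner product\<close>

lemma inner_matrix_mult_right_adjoint:
  fixes A :: "real ^ 'm ^ 'n" and B :: "real ^ 'k ^ 'm"
  shows "(A ** B) \<bullet> C = A \<bullet> (C ** transpose B)"
  by (auto simp: inner_vec_def matrix_matrix_mult_def transpose_def sum_distrib_left sum_distrib_right
      ac_simps intro!: sum.cong sum.swap)

lemma inner_transpose: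
  fixes A B :: "real ^ 'm ^ 'n"
  shows "transpose A \<bullet> transpose B = A \<bullet> B"
  by (simp add: inner_vec_def transpose_def) (rule sum.swap)

lemma inner_matrix_mult_left_adjoint:
  fixes A :: "real ^ 'm ^ 'n" and B :: "real ^ 'k ^ 'm"
  shows "(A ** B) \<bullet> C = B \<bullet> (transpose A ** C)"
proof -
  have "(A ** B) \<bullet> C = (transpose B ** transpose A) \<bullet> transpose C"
    by (metis inner_transpose matrix_transpose_mul)
  also have "\<dots> = transpose B \<bullet> (transpose C ** A)"
    by (simp add: inner_matrix_mult_right_adjoint)
  also have "\<dots> = B \<bullet> (transpose A ** C)"
    by (metis inner_transpose matrix_transpose_mul transpose_transpose)
  finally show ?thesis .
qed

lemma norm_transpose:
  fixes A :: "real ^ 'm ^ 'n"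
  shows "norm (transpose A) = norm A"
  by (simp add: norm_eq_sqrt_inner inner_transpose)

text \<open>Each entry of the product is a row paired with a column, so Cauchy-Schwarz applies
  entrywise and the resulting double sum factors.\<close>

lemma norm_matrix_mult_le:
  fixes A :: "real ^ 'm ^ 'n" and B :: "real ^ 'k ^ 'm"
  shows "norm (A ** B) \<le> norm A * norm B"
proof -
  have entry: "(A ** B) $ i $ j = A $ i \<bullet> transpose B $ j" for i j
    by (simp add: matrix_matrix_mult_def inner_vec_def transpose_def)
  have "(norm (A ** B))\<^sup>2 = (\<Sum>i\<in>UNIV. \<Sum>j\<in>UNIV. ((A ** B) $ i $ j)\<^sup>2)"
    unfolding power2_norm_eq_inner by (simp add: inner_vec_def power2_eq_square)
  also have "\<dots> \<le> (\<Sum>i\<in>UNIV. \<Sum>j\<in>UNIV. (norm (A $ i))\<^sup>2 * (norm (transpose B $ j))\<^sup>2)"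
    unfolding entry power_mult_distrib[symmetric]
    by (intro sum_mono) (simp add: abs_le_square_iff[symmetric] Cauchy_Schwarz_ineq2)
  also have "\<dots> = (norm A)\<^sup>2 * (norm (transpose B))\<^sup>2"
    unfolding power2_norm_eq_inner by (simp add: inner_vec_def[of A] inner_vec_def[of "transpose B"]
        sum_product)
  finally show ?thesis
    by (simp add: norm_transpose power_mult_distrib[symmetric])
qed

interpretation matrix_mult: bounded_bilinear
  "(**) :: real ^ 'm ^ 'n \<Rightarrow> real ^ 'k ^ 'm \<Rightarrow> real ^ 'k ^ 'n"
proof (standard, goal_cases)
  case 1 show ?case by (vector matrix_matrix_mult_def sum.distrib[symmetric] field_simps)
next
  case 2 show ?case by (rule matrix_add_ldistrib)
next
  case 3 show ?case by (rule scalar_matrix_assoc[symmetric])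
next
  case 4 show ?case by (simp add: matrix_scalar_ac scalar_matrix_assoc)
next
  case 5
  show ?case by (rule exI[of _ 1]) (simp add: norm_matrix_mult_le)
qed

lemma bounded_linear_transpose: "bounded_linear (transpose :: real ^ 'm ^ 'n \<Rightarrow> real ^ 'n ^ 'm)"
  by (rule bounded_linear_intro[of _ 1])
    (simp_all add: norm_transpose transpose_scalar, simp add: transpose_def vec_eq_iff)

lemmas transpose_diff = linear_diff[OF bounded_linear.linear[OF bounded_linear_transpose]]

section \<open>Distance to the Stiefel manifold\<close>

definition defect :: "real ^ 'p ^ 'n \<Rightarrow> real ^ 'p ^ 'p" where
  "defect X = transpose X ** X - mat 1"

lemma stiefel_iff_defect: "X \<in> stiefel \<longleftrightarrow> defect X = 0"
  by (simp add: stiefel_def defect_def)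

lemma transpose_defect: "transpose (defect X) = defect X"
  by (simp add: defect_def transpose_diff matrix_transpose_mul)

lemma continuous_on_defect: "continuous_on S defect"
  unfolding defect_def[abs_def]
  by (intro continuous_intros matrix_mult.continuous_on bounded_linear.continuous_on[OF bounded_linear_transpose])

lemma gram_eq: "transpose X ** X = mat 1 + defect X"
  by (simp add: defect_def)

lemma mult_defect_sqnorm:
  "(X ** defect X) \<bullet> (X ** defect X) = (norm (defect X))\<^sup>2 + defect X \<bullet> (defect X ** defect X)"
proof -
  have "(X ** defect X) \<bullet> (X ** defect X) = defect X \<bullet> ((transpose X ** X) ** defect X)"
    by (simp only: inner_matrix_mult_left_adjoint matrix_mul_assoc)
  then show ?thesis
    by (simp add: gram_eq matrix_mult.add_left inner_add_right power2_norm_eq_inner)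
qed

lemma abs_inner_square_le:
  fixes E :: "real ^ 'p ^ 'p"
  shows "\<bar>E \<bullet> (E ** E)\<bar> \<le> (norm E)\<^sup>2 * norm E"
proof -
  have "\<bar>E \<bullet> (E ** E)\<bar> \<le> norm E * norm (E ** E)" by (rule Cauchy_Schwarz_ineq2)
  also have "\<dots> \<le> norm E * (norm E * norm E)"
    by (intro mult_left_mono norm_matrix_mult_le norm_ge_zero)
  finally show ?thesis by (simp add: power2_eq_square)
qed

text \<open>The gradient of the penalty is comparable to the defect. With \<open>q\<close> the
  squared norm of the defect, the cubic term in \<open>mult_defect_sqnorm\<close> is at most
  \<open>q / 4\<close>, so the squared norm of \<open>X ** defect X\<close> lies between
  \<open>3 / 4 * q\<close> and \<open>5 / 4 * q\<close>; the factor 9/8 works as its square 81/64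
  exceeds 5/4.\<close>

lemma norm_mult_defect_bounds:
  assumes "norm (defect X) \<le> 1 / 4"
  shows "(norm (defect X))\<^sup>2 \<le> 2 * ((X ** defect X) \<bullet> (X ** defect X))"
    and "norm (X ** defect X) \<le> 9 / 8 * norm (defect X)"
proof -
  define q where "q = (norm (defect X))\<^sup>2"
  have "q * norm (defect X) \<le> q * (1 / 4)"
    using assms by (intro mult_left_mono) (auto simp: q_def)
  then have "\<bar>defect X \<bullet> (defect X ** defect X)\<bar> \<le> q / 4"
    using abs_inner_square_le[of "defect X"] by (simp add: q_def)
  moreover define c where "c = defect X \<bullet> (defect X ** defect X)"
  moreover have eq: "(X ** defect X) \<bullet> (X ** defect X) = q + c"
    by (simp add: mult_defect_sqnorm q_def c_def)
  moreover have q0: "q \<ge> 0" by (simp add: q_def)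
  ultimately have "q \<le> 2 * (q + c)" "q + c \<le> 5 / 4 * q" by (simp_all add: abs_le_iff)
  note c = this[folded eq]
  show "(norm (defect X))\<^sup>2 \<le> 2 * ((X ** defect X) \<bullet> (X ** defect X))"
    using c(1) by (simp add: q_def)
  have "(norm (X ** defect X))\<^sup>2 \<le> 5 / 4 * q"
    using c(2) by (simp add: power2_norm_eq_inner)
  also have "\<dots> \<le> (9 / 8 * norm (defect X))\<^sup>2"
    using q0 by (simp add: q_def power2_eq_square)
  finally show "norm (X ** defect X) \<le> 9 / 8 * norm (defect X)"
    by (rule power2_le_imp_le) simp
qed

text \<open>This is the Newton-Schulz step towards the polar factor: the terms linear in the defect
  cancel, leaving only quadratic and cubic ones.\<close>

lemma defect_half_step:
  "defect (X - (1 / 2) *\<^sub>R (X ** defect X)) =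
    (1 / 4) *\<^sub>R (defect X ** (defect X ** defect X)) - (3 / 4) *\<^sub>R (defect X ** defect X)"
proof -
  define E where "E = defect X"
  have T: "transpose (X - (1 / 2) *\<^sub>R (X ** E)) = transpose X - (1 / 2) *\<^sub>R (E ** transpose X)"
    by (simp add: transpose_diff transpose_scalar matrix_transpose_mul
        transpose_defect E_def)
  have "transpose (X - (1 / 2) *\<^sub>R (X ** E)) ** (X - (1 / 2) *\<^sub>R (X ** E))
      = (transpose X ** X) - (1 / 2) *\<^sub>R ((transpose X ** X) ** E)
      - (1 / 2) *\<^sub>R (E ** (transpose X ** X)) + (1 / 4) *\<^sub>R (E ** (transpose X ** X) ** E)"
    unfolding T by (simp add: matrix_mult.diff_left matrix_mult.diff_right matrix_mult.scaleR_left
        matrix_mult.scaleR_right matrix_mul_assoc algebra_simps)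
  also have "transpose X ** X = mat 1 + E"
    by (simp add: gram_eq E_def)
  finally have "defect (X - (1 / 2) *\<^sub>R (X ** E)) = E - (1 / 2) *\<^sub>R (E + E ** E)
      - (1 / 2) *\<^sub>R (E + E ** E) + (1 / 4) *\<^sub>R (E ** E + E ** (E ** E))"
    unfolding defect_def[of "X - (1 / 2) *\<^sub>R (X ** E)"]
    by (simp add: matrix_mult.add_left matrix_mult.add_right matrix_mul_assoc)
  then show ?thesis
    unfolding E_def[symmetric] by (simp add: vec_eq_iff field_simps)
qed

text \<open>
  Minimising \<open>\<parallel>defect Z\<parallel> + \<parallel>Z - X\<parallel>\<close> over \<open>Z\<close> replaces the polar decomposition: off the manifold,
  the step from \<open>Z\<close> to \<open>Z - 1/2 Z (Z\<^sup>T Z - I)\<close> would decrease this function.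
\<close>

lemma near_stiefel_point:
  fixes X :: "real ^ 'p ^ 'n"
  assumes "(stiefel :: (real ^ 'p ^ 'n) set) \<noteq> {}" and X: "norm (defect X) \<le> 1 / 4"
  obtains P :: "real ^ 'p ^ 'n" where "P \<in> stiefel" "norm (P - X) \<le> norm (defect X)"
proof -
  obtain Q :: "real ^ 'p ^ 'n" where Q: "defect Q = 0"
    using assms(1) by (auto simp: stiefel_iff_defect)
  define g where "g Z = norm (defect Z) + norm (Z - X)" for Z
  have "continuous_on (cball X (norm (Q - X))) g"
    unfolding g_def[abs_def] by (intro continuous_intros continuous_on_defect)
  then obtain P where P: "P \<in> cball X (norm (Q - X))"
    and min: "\<And>Z. Z \<in> cball X (norm (Q - X)) \<Longrightarrow> g P \<le> g Z"
    using continuous_attains_inf[of "cball X (norm (Q - X))" g] by force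
  \<comment> \<open>Outside the ball the distance term alone is at least
    \<open>norm (Q - X)\<close>, which is \<open>g Q\<close> because \<open>Q\<close> has no defect;
    hence the minimum over the ball is global.\<close>
  have gmin: "g P \<le> g Z" for Z
  proof (cases "Z \<in> cball X (norm (Q - X))")
    case False
    then have "norm (Q - X) \<le> norm (Z - X)" by (simp add: dist_norm norm_minus_commute)
    then have "g Q \<le> g Z" using Q by (simp add: g_def add_increasing)
    moreover have "g P \<le> g Q" by (rule min) (simp add: dist_norm norm_minus_commute)
    ultimately show ?thesis by simp
  qed (rule min)
  have PX: "norm (defect P) + norm (P - X) \<le> norm (defect X)"
    using gmin[of X] by (simp add: g_def)
  define E where "E = defect P"
  have E: "norm E \<le> 1 / 4"
    using PX X norm_ge_zero[of "P - X"] unfolding E_def by linarith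
  have E2: "norm (E ** E) \<le> 1 / 4 * norm E"
    using norm_matrix_mult_le[of E E] mult_right_mono[OF E norm_ge_zero[of E]] by linarith
  have "norm (E ** (E ** E)) \<le> norm E * norm (E ** E)" by (rule norm_matrix_mult_le)
  also have "\<dots> \<le> norm E * (1 / 4 * (1 / 4))"
    using E E2 by (intro mult_left_mono) auto
  finally have E3: "norm (E ** (E ** E)) \<le> 1 / 16 * norm E" by simp
  define Z where "Z = P - (1 / 2) *\<^sub>R (P ** E)"
  have "norm (defect Z) \<le> 1 / 4 * norm (E ** (E ** E)) + 3 / 4 * norm (E ** E)"
    unfolding Z_def E_def defect_half_step
    by (rule order_trans[OF norm_triangle_ineq4]) simp
  moreover have "norm (Z - X) \<le> norm (P - X) + 1 / 2 * norm (P ** E)"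
    using norm_triangle_ineq4[of "P - X" "(1 / 2) *\<^sub>R (P ** E)"] by (simp add: Z_def algebra_simps)
  moreover have "norm (P ** E) \<le> 9 / 8 * norm E"
    unfolding E_def by (rule norm_mult_defect_bounds(2)) (use E in \<open>simp add: E_def\<close>)
  moreover have "norm E + norm (P - X) \<le> norm (defect Z) + norm (Z - X)"
    using gmin[of Z] by (simp add: g_def E_def)
  \<comment> \<open>The new defect costs at most \<open>1/64 + 3/16\<close> and the displacement at
    most \<open>9/16\<close> times \<open>norm E\<close>. The total factor 49/64 is below 1, so
    minimality of \<open>P\<close> forces \<open>E = 0\<close>.\<close>
  ultimately have "norm E \<le> 0" using E2 E3 by linarith
  then have "P \<in> stiefel" by (simp add: stiefel_iff_defect E_def)
  moreover have "norm (P - X) \<le> norm (defect X)"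
    using PX norm_ge_zero[of "defect P"] by linarith
  ultimately show ?thesis by (rule that)
qed

section \<open>The landing field\<close>

text \<open>Symmetry of the defect makes all four terms of the derivative equal, which cancels the
  factor 1/4.\<close>

lemma gderiv_penalty: "GDERIV penalty X :> X ** defect X"
proof -
  have "(defect has_derivative (\<lambda>H. transpose X ** H + transpose H ** X)) (at X)"
    unfolding defect_def[abs_def]
    by (auto intro!: derivative_eq_intros matrix_mult.FDERIV
        bounded_linear.has_derivative[OF bounded_linear_transpose])
  then have "((\<lambda>X. (1 / 4) * (defect X \<bullet> defect X)) has_derivative
      (\<lambda>H. (1 / 4) * (defect X \<bullet> (transpose X ** H + transpose H ** X)
        + (transpose X ** H + transpose H ** X) \<bullet> defect X))) (at X)"
    by (intro derivative_intros)
  moreover have "(1 / 4) * (defect X \<bullet> (transpose X ** H + transpose H ** X)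
        + (transpose X ** H + transpose H ** X) \<bullet> defect X) = H \<bullet> (X ** defect X)" for H
  proof -
    have "(transpose H ** X) \<bullet> defect X = (transpose X ** H) \<bullet> defect X"
      by (metis inner_transpose matrix_transpose_mul transpose_transpose transpose_defect)
    moreover have "(transpose X ** H) \<bullet> defect X = H \<bullet> (X ** defect X)"
      by (simp add: inner_matrix_mult_left_adjoint)
    ultimately show ?thesis
      by (simp add: inner_add_left inner_add_right inner_commute)
  qed
  ultimately show ?thesis
    unfolding gderiv_def penalty_def[abs_def] defect_def[symmetric] power2_norm_eq_inner by simp
qed

lemma landing_eq: "landing lam f X = psi f X ** X + lam *\<^sub>R (X ** defect X)"
  by (simp add: landing_def grad_eqI[OF gderiv_penalty])

lemma psi_eq: "psi f X = grad f X ** transpose X - X ** transpose (grad f X)"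
  by (simp add: psi_def skew_def matrix_transpose_mul)

lemma transpose_psi: "transpose (psi f X) = - psi f X"
  by (simp add: psi_eq transpose_diff matrix_transpose_mul)

text \<open>Moving \<open>X\<close> across the inner product pairs \<open>psi f X\<close> with
  \<open>G\<close>. A skew matrix sees only the skew part of \<open>G\<close>, which is half of
  \<open>psi f X\<close>.\<close>

lemma inner_grad_psi: "grad f X \<bullet> (psi f X ** X) = 1 / 2 * (norm (psi f X))\<^sup>2"
proof -
  define G where "G = grad f X ** transpose X"
  have psi: "psi f X = G - transpose G"
    by (simp add: psi_eq G_def matrix_transpose_mul)
  have "grad f X \<bullet> (psi f X ** X) = psi f X \<bullet> G"
    by (metis G_def inner_commute inner_matrix_mult_right_adjoint)
  moreover have "psi f X \<bullet> transpose G = - (psi f X \<bullet> G)"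
    by (metis inner_minus_left inner_transpose transpose_psi transpose_transpose)
  moreover have "(norm (psi f X))\<^sup>2 = psi f X \<bullet> G - psi f X \<bullet> transpose G"
    by (simp add: power2_norm_eq_inner inner_diff_right[symmetric] psi[symmetric])
  ultimately show ?thesis by simp
qed

text \<open>The inner product equals that of \<open>W\<close> with the symmetric matrix
  \<open>X ** E ** transpose X\<close>. It makes the two components of the landing field
  orthogonal.\<close>

lemma inner_symmetric_skew_mult:
  fixes X :: "real ^ 'p ^ 'n"
  assumes "transpose W = - W" and "transpose E = E"
  shows "(X ** E) \<bullet> (W ** X) = 0"
proof -
  define S where "S = X ** E ** transpose X"
  have S: "transpose S = S"
    by (simp add: S_def matrix_transpose_mul assms matrix_mul_assoc)
  have "(X ** E) \<bullet> (W ** X) = W \<bullet> S"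
    by (metis S_def inner_commute inner_matrix_mult_right_adjoint)
  moreover have "W \<bullet> S = - (W \<bullet> S)"
    by (metis S assms(1) inner_minus_left inner_transpose)
  ultimately show ?thesis by simp
qed

section \<open>Continuity and Lipschitz estimates\<close>

lemma continuous_on_psi:
  assumes "continuous_on S (grad f)"
  shows "continuous_on S (psi f)"
  unfolding psi_eq[abs_def]
  by (intro continuous_intros matrix_mult.continuous_on assms
      bounded_linear.continuous_on[OF bounded_linear_transpose])

lemma lipschitz_on_matrix_mult:
  fixes f :: "'a::metric_space \<Rightarrow> real ^ 'm ^ 'n" and g :: "'a \<Rightarrow> real ^ 'k ^ 'm"
  assumes S: "compact S" and "\<exists>L. L-lipschitz_on S f" and "\<exists>L. L-lipschitz_on S g"
  shows "\<exists>L. L-lipschitz_on S (\<lambda>x. f x ** g x)"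
proof -
  obtain A B where f: "A-lipschitz_on S f" and g: "B-lipschitz_on S g" using assms by blast
  have "bounded (f ` S)" "bounded (g ` S)"
    using S f g by (auto intro!: compact_imp_bounded compact_continuous_image
        lipschitz_on_continuous_on)
  then obtain a b where a: "a > 0" "\<And>x. x \<in> S \<Longrightarrow> norm (f x) \<le> a"
    and b: "b > 0" "\<And>x. x \<in> S \<Longrightarrow> norm (g x) \<le> b"
    by (auto simp: bounded_pos)
  have AB: "A \<ge> 0" "B \<ge> 0" using f g lipschitz_on_nonneg by auto
  have "(A * b + a * B)-lipschitz_on S (\<lambda>x. f x ** g x)"
  proof (rule lipschitz_onI)
    fix x y assume xy: "x \<in> S" "y \<in> S"
    have "dist (f x ** g x) (f y ** g y) = norm ((f x - f y) ** g x + f y ** (g x - g y))"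
      by (simp add: dist_norm matrix_mult.diff_left matrix_mult.diff_right)
    also have "\<dots> \<le> norm (f x - f y) * norm (g x) + norm (f y) * norm (g x - g y)"
      by (intro order_trans[OF norm_triangle_ineq] add_mono norm_matrix_mult_le)
    also have "\<dots> \<le> (A * dist x y) * b + a * (B * dist x y)"
      using lipschitz_onD[OF f xy] lipschitz_onD[OF g xy] a b xy AB
      by (intro add_mono mult_mono) (auto simp: dist_norm)
    finally show "dist (f x ** g x) (f y ** g y) \<le> (A * b + a * B) * dist x y"
      by (simp add: algebra_simps)
  qed (use AB a b in auto)
  then show ?thesis by blast
qed

lemma lipschitz_on_transpose:
  fixes f :: "'a::metric_space \<Rightarrow> real ^ 'm ^ 'n"
  assumes "L-lipschitz_on S f"
  shows "L-lipschitz_on S (\<lambda>x. transpose (f x))"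
  using assms by (simp add: lipschitz_on_def dist_norm transpose_diff[symmetric] norm_transpose)

lemma lipschitz_on_landing:
  fixes f :: "real ^ 'p ^ 'n \<Rightarrow> real"
  assumes S: "compact S" and f: "L-lipschitz_on S (grad f)"
  shows "\<exists>M. M-lipschitz_on S (\<lambda>X. - landing lam f X)"
proof -
  have diff: "\<exists>L. L-lipschitz_on S (\<lambda>x. h x - k x)"
    if "\<exists>L. L-lipschitz_on S h" "\<exists>L. L-lipschitz_on S k"
    for h k :: "real ^ 'p ^ 'n \<Rightarrow> 'c::real_normed_vector"
    using that lipschitz_on_diff by blast
  have id: "\<exists>L. L-lipschitz_on S (\<lambda>x. x)" using lipschitz_on_id by blast
  have id': "\<exists>L. L-lipschitz_on S transpose"
    using lipschitz_on_transpose[OF lipschitz_on_id] by blast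
  have g: "\<exists>L. L-lipschitz_on S (grad f)" "\<exists>L. L-lipschitz_on S (\<lambda>x. transpose (grad f x))"
    using f lipschitz_on_transpose by blast+
  have "\<exists>L. L-lipschitz_on S (\<lambda>X. psi f X ** X)"
    unfolding psi_eq by (intro lipschitz_on_matrix_mult diff S id id' g)
  moreover have "\<exists>L. L-lipschitz_on S (\<lambda>X. X ** defect X)"
    unfolding defect_def
    by (intro lipschitz_on_matrix_mult diff S id id') (use lipschitz_on_constant in blast)
  ultimately obtain A B where A: "A-lipschitz_on S (\<lambda>X. psi f X ** X)"
    and B: "B-lipschitz_on S (\<lambda>X. X ** defect X)" by blast
  have "(A + \<bar>lam\<bar> * B)-lipschitz_on S (\<lambda>X. landing lam f X)"
    unfolding landing_eq by (intro lipschitz_on_add lipschitz_on_cmult A B)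
  then show ?thesis by (auto simp: lipschitz_on_minus_iff)
qed

lemma lipschitz_on_bounded_gderiv:
  fixes f :: "'a::real_inner \<Rightarrow> real"
  assumes "convex S" and "0 \<le> B"
    and "\<And>x. x \<in> S \<Longrightarrow> GDERIV f x :> D x" and "\<And>x. x \<in> S \<Longrightarrow> norm (D x) \<le> B"
  shows "B-lipschitz_on S f"
proof (rule lipschitz_onI)
  fix x y assume xy: "x \<in> S" "y \<in> S"
  have "norm (f x - f y) \<le> B * norm (x - y)"
  proof (rule differentiable_bound[OF assms(1) _ _ xy])
    fix z assume z: "z \<in> S"
    show "(f has_derivative (\<lambda>h. h \<bullet> D z)) (at z within S)"
      using assms(3)[OF z] unfolding gderiv_def by (rule has_derivative_at_withinI)
    show "onorm (\<lambda>h. h \<bullet> D z) \<le> B"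
    proof (rule onorm_bound[OF assms(2)])
      fix h
      have "norm (h \<bullet> D z) \<le> norm h * norm (D z)" by (simp add: Cauchy_Schwarz_ineq2)
      also have "\<dots> \<le> norm h * B" using assms(4)[OF z] by (intro mult_left_mono) auto
      finally show "norm (h \<bullet> D z) \<le> B * norm h" by (simp add: mult.commute)
    qed
  qed
  then show "dist (f x) (f y) \<le> B * dist x y" by (simp add: dist_norm)
qed (rule assms(2))

section \<open>First-order condition at local minima on the manifold\<close>

text \<open>
  The curve \<open>Y - h \<psi>(Y) Y\<close> leaves the manifold only to second order in \<open>h\<close>, while \<open>f\<close> decreases
  along it to first order unless \<open>\<psi>(Y) = 0\<close>.
\<close>

lemma local_min_psi_eq_0:
  fixes f :: "real ^ 'p ^ 'n \<Rightarrow> real"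
  assumes Y: "local_min_on f stiefel Y" and diff: "f differentiable (at Y)"
    and \<rho>: "\<rho> > 0" and f: "C-lipschitz_on (ball Y \<rho>) f"
  shows "psi f Y = 0"
proof (rule ccontr)
  assume "psi f Y \<noteq> 0"
  define W where "W = psi f Y"
  define D where "D = W ** Y"
  define c where "c = norm (transpose Y ** (W ** (W ** Y)))"
  have Yst: "Y \<in> stiefel" using Y by (simp add: local_min_on_def)
  then have YY: "transpose Y ** Y = mat 1" by (simp add: stiefel_def)
  obtain r where r: "r > 0" "\<And>Z. Z \<in> stiefel \<Longrightarrow> dist Z Y < r \<Longrightarrow> f Y \<le> f Z"
    using Y by (auto simp: local_min_on_def)
  \<comment> \<open>As \<open>W\<close> is skew, the two terms of first order in \<open>h\<close>
    cancel.\<close>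
  have defect: "norm (defect (Y - h *\<^sub>R D)) = c * h\<^sup>2" for h
  proof -
    have T: "transpose (Y - h *\<^sub>R D) = transpose Y + h *\<^sub>R (transpose Y ** W)"
      by (simp add: D_def transpose_diff transpose_scalar matrix_transpose_mul W_def transpose_psi
          matrix_mult.minus_right)
    have "transpose (Y - h *\<^sub>R D) ** (Y - h *\<^sub>R D)
        = mat 1 - (h * h) *\<^sub>R (transpose Y ** (W ** (W ** Y)))"
      unfolding T by (simp add: D_def matrix_mult.diff_right matrix_mult.add_left
          matrix_mult.scaleR_left matrix_mult.scaleR_right matrix_mul_assoc YY scaleR_add_right)
    then show ?thesis by (simp add: defect_def c_def power2_eq_square)
  qed
  \<comment> \<open>An upper bound for \<open>f\<close> at a manifold point within
    \<open>c * h\<^sup>2\<close> of the curve. Its derivative at 0 is that of \<open>f\<close> along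
    the curve, hence negative, so some such point lies below \<open>f Y\<close>.\<close>
  define k where "k h = f (Y - h *\<^sub>R D) + C * (c * h\<^sup>2)" for h
  have "GDERIV f Y :> grad f Y" using diff by (rule gderiv_grad)
  then have "(f has_derivative (\<lambda>H. H \<bullet> grad f Y)) (at (Y - 0 *\<^sub>R D))"
    by (simp add: gderiv_def)
  then have "((\<lambda>h. f (Y - h *\<^sub>R D)) has_derivative (\<lambda>h. (- (h *\<^sub>R D)) \<bullet> grad f Y)) (at 0)"
    by (rule has_derivative_compose[rotated]) (auto intro!: derivative_eq_intros)
  then have "(k has_derivative (\<lambda>h. (- (h *\<^sub>R D)) \<bullet> grad f Y)) (at 0)"
    unfolding k_def by (auto intro!: derivative_eq_intros)
  then have "(k has_real_derivative - (grad f Y \<bullet> D)) (at 0)"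
    unfolding has_field_derivative_def
    by (rule has_derivative_eq_rhs) (auto simp: inner_commute)
  moreover have "grad f Y \<bullet> D > 0"
    using \<open>psi f Y \<noteq> 0\<close> by (simp add: D_def W_def inner_grad_psi)
  ultimately obtain d where d: "d > 0" "\<And>h. 0 < h \<Longrightarrow> h < d \<Longrightarrow> k h < k 0"
    using DERIV_neg_dec_right[of k "- (grad f Y \<bullet> D)" 0] by auto
  \<comment> \<open>The three bounds serve \<open>near_stiefel_point\<close>, the local minimality
    of \<open>Y\<close> and the Lipschitz estimate for \<open>f\<close>.\<close>
  define e where "e = min (1 / 4) (min r \<rho>)"
  have e: "e > 0" using r \<rho> by (simp add: e_def)
  have "((\<lambda>h. h * norm D + c * h\<^sup>2) \<longlongrightarrow> 0 * norm D + c * 0\<^sup>2) (at_right 0)"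
    by (intro tendsto_intros)
  then have "\<forall>\<^sub>F h in at_right 0. h * norm D + c * h\<^sup>2 < e"
    using e by (intro order_tendstoD) auto
  moreover have "\<forall>\<^sub>F h in at_right 0. 0 < h \<and> h < d"
    using d(1) by (auto simp: eventually_at_right_field)
  ultimately have "\<forall>\<^sub>F h in at_right (0::real). 0 < h \<and> h < d \<and> h * norm D + c * h\<^sup>2 < e"
    by eventually_elim auto
  then obtain h where h: "0 < h" "h < d" "h * norm D + c * h\<^sup>2 < e"
    using eventually_happens trivial_limit_at_right_real by blast
  have c0: "c * h\<^sup>2 \<ge> 0" by (simp add: c_def)
  have hD: "h * norm D \<ge> 0" using h by simp
  have "norm (defect (Y - h *\<^sub>R D)) \<le> 1 / 4"
    using h(3) hD unfolding defect e_def by linarith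
  then obtain P where P: "P \<in> stiefel" "norm (P - (Y - h *\<^sub>R D)) \<le> c * h\<^sup>2"
    using near_stiefel_point[of "Y - h *\<^sub>R D"] Yst unfolding defect by blast
  have "norm (P - Y) \<le> norm (P - (Y - h *\<^sub>R D)) + norm (h *\<^sub>R D)"
    using norm_triangle_ineq4[of "P - (Y - h *\<^sub>R D)" "h *\<^sub>R D"] by simp
  then have PY: "dist P Y < e" using P h by (simp add: dist_norm)
  have "f Y \<le> f P" using r(2)[OF P(1)] PY by (simp add: e_def)
  moreover have "dist (f P) (f (Y - h *\<^sub>R D)) \<le> C * dist P (Y - h *\<^sub>R D)"
  proof (rule lipschitz_onD[OF f])
    show "P \<in> ball Y \<rho>" using PY by (simp add: e_def dist_commute)
    show "Y - h *\<^sub>R D \<in> ball Y \<rho>" using h c0 by (simp add: e_def dist_norm)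
  qed
  moreover have "C * dist P (Y - h *\<^sub>R D) \<le> C * (c * h\<^sup>2)"
    using P lipschitz_on_nonneg[OF f] by (intro mult_left_mono) (auto simp: dist_norm)
  ultimately have "k 0 \<le> k h" by (simp add: k_def dist_real_def)
  then show False using d(2)[OF h(1,2)] by simp
qed

section \<open>Decrease along the landing flow\<close>

text \<open>
  The penalty \<open>K \<parallel>X\<^sup>T X - I\<parallel>\<close> is not differentiable on the manifold, so the estimate is proved for
  \<open>K sqrt (\<parallel>X\<^sup>T X - I\<parallel>\<^sup>2 + \<eta>\<^sup>2)\<close> first.
\<close>

lemma landing_smoothed_decrease:
  assumes lam: "lam > 0" and \<eta>: "\<eta> > 0" and C: "norm (grad f X) \<le> C"
    and X: "norm (defect X) \<le> 1 / 4"
    and K: "K * lam = 9 / 8 * lam * C + 1"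
  shows "(- landing lam f X) \<bullet>
      (grad f X + (2 * K / sqrt ((norm (defect X))\<^sup>2 + \<eta>\<^sup>2)) *\<^sub>R (X ** defect X))
    \<le> - (1 / 2 * (norm (psi f X))\<^sup>2 + norm (defect X)) + K * lam * \<eta>"
proof -
  define e where "e = norm (defect X)"
  define s where "s = sqrt (e\<^sup>2 + \<eta>\<^sup>2)"
  define N where "N = (X ** defect X) \<bullet> (X ** defect X)"
  have e: "e \<ge> 0" by (simp add: e_def)
  have C0: "C \<ge> 0" using C norm_ge_zero order_trans by blast
  have K0: "K * lam \<ge> 0" using K lam C0 by simp
  have s: "s > 0" "s \<le> e + \<eta>"
    using e \<eta> sqrt_sum_squares_le_sum[of e \<eta>] by (auto simp: s_def add_nonneg_pos)
  have "grad f X \<bullet> (X ** defect X) \<ge> - (9 / 8 * C * e)"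
  proof -
    have "\<bar>grad f X \<bullet> (X ** defect X)\<bar> \<le> norm (grad f X) * norm (X ** defect X)"
      by (rule Cauchy_Schwarz_ineq2)
    also have "\<dots> \<le> C * (9 / 8 * e)"
      using C C0 norm_mult_defect_bounds(2)[OF X] by (intro mult_mono) (auto simp: e_def)
    finally show ?thesis by (simp add: abs_le_iff)
  qed
  from mult_left_mono[OF this, of lam]
  have 1: "- (lam * (grad f X \<bullet> (X ** defect X))) \<le> 9 / 8 * lam * C * e"
    using lam by (simp add: algebra_simps)
  \<comment> \<open>Smoothing costs only \<open>\<eta>\<close>: since
    \<open>s \<le> e + \<eta>\<close>, the quotient \<open>2 * N / s\<close> is at least
    \<open>e - \<eta>\<close>, where the unsmoothed rate would give \<open>e\<close>.\<close>
  have "(e - \<eta>) * s \<le> e\<^sup>2"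
  proof (cases "e \<le> \<eta>")
    case True
    then have "(e - \<eta>) * s \<le> 0" using s by (simp add: mult_nonpos_nonneg)
    then show ?thesis by (simp add: order_trans)
  next
    case False
    then have "(e - \<eta>) * s \<le> (e - \<eta>) * (e + \<eta>)" using s by (intro mult_left_mono) auto
    also have "\<dots> = e\<^sup>2 - \<eta>\<^sup>2" by (simp add: algebra_simps power2_eq_square)
    finally show ?thesis using zero_le_power2[of \<eta>] by linarith
  qed
  also have "e\<^sup>2 \<le> 2 * N"
    using norm_mult_defect_bounds(1)[OF X] by (simp add: e_def N_def)
  finally have "e - \<eta> \<le> 2 * N / s" using s by (simp add: field_simps)
  from mult_left_mono[OF this K0]
  have 2: "- (2 * K / s * lam * N) \<le> - (K * lam * (e - \<eta>))" by (simp add: ac_simps)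
  have 3: "(X ** defect X) \<bullet> (psi f X ** X) = 0"
    by (rule inner_symmetric_skew_mult[OF transpose_psi transpose_defect])
  have "(- landing lam f X) \<bullet> (grad f X + (2 * K / s) *\<^sub>R (X ** defect X))
      = - (1 / 2 * (norm (psi f X))\<^sup>2) - lam * (grad f X \<bullet> (X ** defect X)) - 2 * K / s * lam * N"
    using 3 inner_grad_psi[of f X]
    by (simp add: landing_eq inner_add_left inner_add_right inner_diff_left N_def inner_commute
        algebra_simps)
  also have "\<dots> \<le> - (1 / 2 * (norm (psi f X))\<^sup>2) + 9 / 8 * lam * C * e - K * lam * (e - \<eta>)"
    using 1 2 by linarith
  also have "\<dots> = - (1 / 2 * (norm (psi f X))\<^sup>2 + e) + K * lam * \<eta>"
    using arg_cong[OF K, of "\<lambda>z. z * e"] by (simp add: right_diff_distrib distrib_right)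
  finally show ?thesis by (simp add: e_def s_def)
qed

text \<open>The mean value theorem is applied to the smoothed function. Comparing it with the
  original costs \<open>K * \<eta>\<close>, the perturbed rate costs
  \<open>K * lam * (t - s) * \<eta>\<close>, and both vanish as \<open>\<eta>\<close> tends to
  0.\<close>

lemma landing_decrease:
  fixes f :: "real ^ 'p ^ 'n \<Rightarrow> real"
  assumes lam: "lam > 0" and K: "K * lam = 9 / 8 * lam * C + 1" and C0: "C \<ge> 0"
    and diff: "\<And>X. f differentiable (at X)"
    and C: "\<And>X. X \<in> B \<Longrightarrow> norm (grad f X) \<le> C"
    and B: "\<And>X. X \<in> B \<Longrightarrow> norm (defect X) \<le> 1 / 4"
    and st: "s \<le> t"
    and u: "\<And>\<tau>. \<tau> \<in> {s..t} \<Longrightarrow>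
      (u has_vector_derivative - landing lam f (u \<tau>)) (at \<tau> within {s..t})"
    and c: "\<And>\<tau>. \<tau> \<in> {s..t} \<Longrightarrow>
      u \<tau> \<in> B \<and> c \<le> 1 / 2 * (norm (psi f (u \<tau>)))\<^sup>2 + norm (defect (u \<tau>))"
  shows "f (u t) + K * norm (defect (u t)) \<le> f (u s) + K * norm (defect (u s)) - c * (t - s)"
proof -
  have "K * lam > 0" using K lam C0 by (simp add: add_nonneg_pos)
  then have K0: "K > 0" using lam by (simp add: zero_less_mult_iff)
  have "f (u t) + K * norm (defect (u t))
      \<le> f (u s) + K * norm (defect (u s)) - c * (t - s) + (K + K * lam * (t - s)) * \<eta>"
    if \<eta>: "\<eta> > 0" for \<eta>
  proof -
    \<comment> \<open>Writing the smoothed norm through \<open>penalty\<close> lets the chain rule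
      use the gradient already computed.\<close>
    define v where "v X = f X + K * sqrt (4 * penalty X + \<eta>\<^sup>2)" for X
    have p: "4 * penalty X = (norm (defect X))\<^sup>2" for X :: "real ^ 'p ^ 'n"
      by (simp add: penalty_def defect_def)
    define D where "D X = grad f X +
        (2 * K / sqrt ((norm (defect X))\<^sup>2 + \<eta>\<^sup>2)) *\<^sub>R (X ** defect X)" for X
    have v: "(v has_derivative (\<lambda>h. h \<bullet> D X)) (at X)" for X
    proof -
      have pos: "4 * penalty X + \<eta>\<^sup>2 > 0" using \<eta> by (simp add: p add_nonneg_pos)
      have "((\<lambda>z. 4 * z + \<eta>\<^sup>2) has_real_derivative 4) (at (penalty X))"
        by (auto intro!: derivative_eq_intros)
      from DERIV_cmult[OF DERIV_chain2[where f = sqrt and g = "\<lambda>z. 4 * z + \<eta>\<^sup>2" and x = "penalty X",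
            OF DERIV_real_sqrt[OF pos] this], of K]
      have "((\<lambda>z. K * sqrt (4 * z + \<eta>\<^sup>2)) has_real_derivative
          2 * K / sqrt ((norm (defect X))\<^sup>2 + \<eta>\<^sup>2)) (at (penalty X))"
        by (rule DERIV_cong) (simp add: p inverse_eq_divide)
      from GDERIV_add[OF gderiv_grad[OF diff] GDERIV_DERIV_compose[OF gderiv_penalty this]]
      show ?thesis by (simp add: gderiv_def D_def v_def[abs_def])
    qed
    have "((\<lambda>\<tau>. v (u \<tau>)) has_derivative (\<lambda>h. (h *\<^sub>R (- landing lam f (u \<tau>))) \<bullet> D (u \<tau>)))
        (at \<tau> within {s..t})" if "\<tau> \<in> {s..t}" for \<tau>
      using has_derivative_compose[OF u[OF that, unfolded has_vector_derivative_def] v] .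
    from mvt_very_simple[OF st this] obtain \<tau> where \<tau>: "\<tau> \<in> {s..t}"
      and eq: "v (u t) - v (u s) = (t - s) * ((- landing lam f (u \<tau>)) \<bullet> D (u \<tau>))"
      by auto
    have "(- landing lam f (u \<tau>)) \<bullet> D (u \<tau>)
        \<le> - (1 / 2 * (norm (psi f (u \<tau>)))\<^sup>2 + norm (defect (u \<tau>))) + K * lam * \<eta>"
      unfolding D_def using c[OF \<tau>] C B by (intro landing_smoothed_decrease[OF lam \<eta> _ _ K]) auto
    also have "\<dots> \<le> - c + K * lam * \<eta>" using c[OF \<tau>] by simp
    finally have "v (u t) - v (u s) \<le> (t - s) * (- c + K * lam * \<eta>)"
      unfolding eq using st by (intro mult_left_mono) auto
    moreover have "f (u t) + K * norm (defect (u t)) \<le> v (u t)"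
      unfolding v_def p using K0 real_sqrt_sum_squares_ge1[of "norm (defect (u t))" \<eta>] by simp
    moreover have "v (u s) \<le> f (u s) + K * (norm (defect (u s)) + \<eta>)"
      unfolding v_def p using K0 \<eta> sqrt_sum_squares_le_sum[of "norm (defect (u s))" \<eta>] by simp
    moreover have "(t - s) * (- c + K * lam * \<eta>) + K * (norm (defect (u s)) + \<eta>)
        = K * norm (defect (u s)) - c * (t - s) + (K + K * lam * (t - s)) * \<eta>"
      by (simp add: algebra_simps)
    ultimately show ?thesis by linarith
  qed
  note bound = this
  have M: "K + K * lam * (t - s) > 0"
    using K0 lam st by (simp add: add_pos_nonneg)
  show ?thesis
  proof (rule field_le_epsilon)
    fix \<epsilon> :: real assume "\<epsilon> > 0"
    then show "f (u t) + K * norm (defect (u t))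
        \<le> f (u s) + K * norm (defect (u s)) - c * (t - s) + \<epsilon>"
      using bound[of "\<epsilon> / (K + K * lam * (t - s))"] M by simp
  qed
qed

section \<open>Choice of the neighbourhood and verification of the Lyapunov conditions\<close>

theorem theorem8:
  fixes f :: "real ^ 'p ^ 'n \<Rightarrow> real"
    and lam :: real
    and Xs :: "real ^ 'p ^ 'n"
  assumes "CARD('p) \<le> CARD('n)"
    and "lam > 0"
    and "\<And>X. f differentiable (at X)"
    and "continuous_on UNIV (grad f)"
    and "\<And>X. \<exists>r>0. \<exists>L. L-lipschitz_on (ball X r) (grad f)"
    and "local_min_on f stiefel Xs"
    and "Xs isolated_in critical_points f"
  shows "asymptotically_stable_point (\<lambda>X. - landing lam f X) Xs"
proof -
  have lam: "lam > 0" and diff: "\<And>X. f differentiable (at X)"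
    and cont: "continuous_on UNIV (grad f)" by fact+
  obtain d1 where d1: "d1 > 0" "\<And>X. X \<in> critical_points f \<Longrightarrow> dist Xs X < d1 \<Longrightarrow> X = Xs"
    and crit: "Xs \<in> critical_points f"
    using assms(7) unfolding isolated_in_dist_Ex_iff by blast
  obtain d2 where d2: "d2 > 0" "\<And>X. X \<in> stiefel \<Longrightarrow> dist X Xs < d2 \<Longrightarrow> f Xs \<le> f X"
    and st: "Xs \<in> stiefel"
    using assms(6) unfolding local_min_on_def by blast
  obtain d3 L where d3: "d3 > 0" and L: "L-lipschitz_on (ball Xs d3) (grad f)"
    using assms(5) by blast
  have defect0: "defect Xs = 0" using st by (simp add: stiefel_iff_defect)
  \<comment> \<open>Points \<open>X\<close> will be within \<open>R\<close> of \<open>Xs\<close> and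
    their manifold neighbours within \<open>R\<close> of \<open>X\<close>, so minimality and the
    gradient bounds are needed up to distance \<open>2 * R\<close>.\<close>
  define R where "R = min d2 d3 / 4"
  have R: "R > 0" "2 * R < d2" "2 * R < d3" using d2 d3 by (auto simp: R_def)
  have "continuous (at Xs) defect"
    using continuous_on_defect[of "UNIV :: (real ^ 'p ^ 'n) set"] by (simp add: continuous_on_eq_continuous_at)
  moreover have "min (1 / 4) R > 0" using R by simp
  ultimately obtain d4 where d4: "d4 > 0"
    "\<And>X. dist X Xs < d4 \<Longrightarrow> dist (defect X) (defect Xs) < min (1 / 4) R"
    unfolding continuous_at_eps_delta by blast
  \<comment> \<open>Halving makes the bounds strict on the closed ball: there the defect is small by
    \<open>d4\<close>, and no critical point other than \<open>Xs\<close> occurs by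
    \<open>d1\<close>.\<close>
  define r where "r = min (min d4 d1) R / 2"
  have r: "r > 0" "r < d4" "r < d1" "r < R" using d4 d1 R by (auto simp: r_def)
  have defect_le: "norm (defect X) \<le> 1 / 4" "norm (defect X) \<le> R" if "X \<in> cball Xs r" for X
    using d4(2)[of X] that r defect0 by (auto simp: dist_norm norm_minus_commute)
  have "bounded (grad f ` cball Xs (2 * R))"
    by (intro compact_imp_bounded compact_continuous_image continuous_on_subset[OF cont]) auto
  then obtain C where C0: "C > 0" and C: "\<And>X. X \<in> cball Xs (2 * R) \<Longrightarrow> norm (grad f X) \<le> C"
    by (auto simp: bounded_pos)
  have fC: "C-lipschitz_on (cball Xs (2 * R)) f"
    by (rule lipschitz_on_bounded_gderiv) (use C0 C gderiv_grad[OF diff] in auto)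
  have sub: "cball Xs r \<subseteq> cball Xs (2 * R)" using r by auto
  \<comment> \<open>The first summand absorbs the change of \<open>f\<close> caused by the penalty
    component, with 9/8 from \<open>norm_mult_defect_bounds\<close>; the second leaves a decrease at
    the full rate \<open>norm (defect X)\<close>. It also gives \<open>K > C\<close>, needed for
    positivity of \<open>V\<close>.\<close>
  define K where "K = 9 / 8 * C + 1 / lam"
  have K: "K * lam = 9 / 8 * lam * C + 1" using lam by (simp add: K_def field_simps)
  have "1 / lam > 0" using lam by simp
  then have KC: "K > C" using C0 unfolding K_def by linarith
  have critical: "X = Xs" if X: "X \<in> cball Xs r" "defect X = 0" "psi f X = 0" for X
  proof -
    have "X \<in> critical_points f" using X by (simp add: critical_points_def stiefel_iff_defect)
    then show ?thesis using d1(2)[of X] X(1) r by simp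
  qed
  define V where "V X = f X + K * norm (defect X)" for X
  define w where "w X = 1 / 2 * (norm (psi f X))\<^sup>2 + norm (defect X)" for X
  have Vpos: "V Xs < V X" if X: "X \<in> cball Xs r" "X \<noteq> Xs" for X
  proof -
    obtain P where P: "P \<in> stiefel" "norm (P - X) \<le> norm (defect X)"
      using near_stiefel_point[OF _ defect_le(1)[OF X(1)]] st by blast
    have "norm (P - Xs) \<le> norm (P - X) + norm (X - Xs)"
      using norm_triangle_ineq[of "P - X" "X - Xs"] by simp
    then have PR: "dist P Xs \<le> 2 * R"
      using P(2) defect_le(2)[OF X(1)] X(1) r by (simp add: dist_norm norm_minus_commute)
    then have "f Xs \<le> f P" using d2(2)[OF P(1)] R by simp
    moreover have "\<bar>f P - f X\<bar> \<le> C * norm (P - X)"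
      using lipschitz_onD[OF fC, of P X] PR X(1) r R by (auto simp: dist_norm norm_minus_commute)
    moreover have "C * norm (P - X) \<le> C * norm (defect X)"
      using P(2) C0 by (intro mult_left_mono) auto
    \<comment> \<open>Exact penalisation: leaving the manifold lowers \<open>f\<close> by at most
      \<open>C\<close> times the defect, which \<open>K > C\<close> overcompensates.\<close>
    ultimately have fX: "f Xs \<le> f X + C * norm (defect X)" by linarith
    show ?thesis
    proof (cases "defect X = 0")
      case False
      then have "C * norm (defect X) < K * norm (defect X)" using KC by simp
      then show ?thesis using fX by (simp add: V_def defect0)
    next
      case True
      have "f X \<noteq> f Xs"
      proof
        assume eq: "f X = f Xs"
        \<comment> \<open>Minimality passes from \<open>Xs\<close> to \<open>X\<close>, because the
          values agree and the \<open>R\<close>-ball about \<open>X\<close> lies within distance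
          \<open>d2\<close> of \<open>Xs\<close>.\<close>
        have "local_min_on f stiefel X"
          unfolding local_min_on_def
        proof (intro conjI exI[of _ R] ballI impI)
          show "X \<in> stiefel" using True by (simp add: stiefel_iff_defect)
          fix Y :: "real ^ 'p ^ 'n" assume Y: "Y \<in> stiefel" "dist Y X < R"
          have "dist Y Xs < d2"
            using dist_triangle[of Y Xs X] Y(2) X(1) r R by (simp add: dist_commute)
          then show "f X \<le> f Y" using d2(2)[OF Y(1)] eq by simp
        qed (rule R)
        moreover have "ball X R \<subseteq> cball Xs (2 * R)"
        proof
          fix Y assume "Y \<in> ball X R"
          then show "Y \<in> cball Xs (2 * R)"
            using dist_triangle[of Xs Y X] X(1) r by simp
        qed
        ultimately have "psi f X = 0"
          using local_min_psi_eq_0[OF _ diff R(1) lipschitz_on_subset[OF fC]] by blast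
        then show False using critical[OF X(1) True] X(2) by simp
      qed
      then show ?thesis using fX True by (simp add: V_def defect0)
    qed
  qed
  have "\<exists>M. M-lipschitz_on (cball Xs r) (\<lambda>X. - landing lam f X)"
    by (rule lipschitz_on_landing[OF compact_cball lipschitz_on_subset[OF L]]) (use r R in auto)
  then obtain M where M: "M-lipschitz_on (cball Xs r) (\<lambda>X. - landing lam f X)" ..
  show ?thesis
  proof (rule lyapunov_asymptotically_stable[OF r(1) M, of V w])
    show "- landing lam f Xs = 0"
      using crit by (simp add: landing_eq defect0 critical_points_def)
    have "continuous_on S f" for S
      using diff by (intro differentiable_imp_continuous_on)
        (auto simp: differentiable_on_def intro: differentiable_at_withinI)
    then show "continuous_on (cball Xs r) V"
      unfolding V_def[abs_def] by (intro continuous_intros continuous_on_defect)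
    show "continuous_on (cball Xs r) w"
      unfolding w_def[abs_def]
      by (intro continuous_intros continuous_on_defect continuous_on_psi continuous_on_subset[OF cont])
        auto
    show "V Xs < V X" if "X \<in> cball Xs r" "X \<noteq> Xs" for X using Vpos[OF that] .
    show "0 < w X" if X: "X \<in> cball Xs r" "X \<noteq> Xs" for X
    proof -
      have "defect X \<noteq> 0 \<or> psi f X \<noteq> 0" using critical[OF X(1)] X(2) by blast
      then show ?thesis by (auto simp: w_def add_pos_nonneg add_nonneg_pos)
    qed
    show "0 \<le> w Xs" by (simp add: w_def)
    show "V (u t) \<le> V (u s) - c * (t - s)"
      if "s \<le> t" "\<And>\<tau>. \<tau> \<in> {s..t} \<Longrightarrow>
          (u has_vector_derivative - landing lam f (u \<tau>)) (at \<tau> within {s..t})"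
        "\<And>\<tau>. \<tau> \<in> {s..t} \<Longrightarrow> u \<tau> \<in> cball Xs r \<and> c \<le> w (u \<tau>)" for u s t c
      unfolding V_def
      by (rule landing_decrease[OF lam K less_imp_le[OF C0] diff C[OF subsetD[OF sub]]
            defect_le(1) that[unfolded w_def]])
  qed
qed

end
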